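(* For all positive integers $t$ and $n$ with $n\ge t+2$, there exists an $n$-vertex graph $G$ with edge-cost functions $c_1,\dots,c_t\colon E(G)\to\mathbb{R}_+$ such that $G$ has at least $\left(\frac{n-2}{t}\right)^t$ distinct pareto-optimal cuts.
   Context: For $U\subseteq V$, $\delta(U)$ is the set of edges with one endpoint in $U$ and one in $V\setminus U$; a cut is $\delta(U)$ for $\emptyset\ne U\subsetneq V$; $c_i(F)=\sum_{e\in F}c_i(e)$. A cut $F'$ dominates a cut $F$ if $c_i(F')\le c_i(F)$ for every $i\in[t]$ and $c_i(F')<c_i(F)$ for some $i$. A cut is pareto-optimal if no other cut dominates it. *)

theory Defs
  imports Complex_Main
begin

definition simple_graph :: "'v set \<Rightarrow> 'v set set \<Rightarrow> bool" where
  "simple_graph V E \<longleftrightarrow> finite V \<and> E \<subseteq> {{u, v} | u v. u \<in> V \<and> v \<in> V \<and> u \<noteq> v}"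

definition edge_boundary :: "'v set \<Rightarrow> 'v set set \<Rightarrow> 'v set \<Rightarrow> 'v set set" where
  "edge_boundary V E U = {e \<in> E. \<exists>u\<in>U. \<exists>v\<in>V - U. e = {u, v}}"

text \<open>Cuts are sets of edges, not vertex bipartitions: two vertex sets with the same
  boundary give one cut.\<close>

definition cuts :: "'v set \<Rightarrow> 'v set set \<Rightarrow> 'v set set set" where
  "cuts V E = {edge_boundary V E U | U. U \<noteq> {} \<and> U \<subset> V}"

definition dominates :: "nat \<Rightarrow> (nat \<Rightarrow> 'e \<Rightarrow> real) \<Rightarrow> 'e set \<Rightarrow> 'e set \<Rightarrow> bool" where
  "dominates t c F' F \<longleftrightarrow>
     (\<forall>i\<in>{1..t}. sum (c i) F' \<le> sum (c i) F) \<and> (\<exists>i\<in>{1..t}. sum (c i) F' < sum (c i) F)"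

definition pareto_optimal_cuts ::
    "'v set \<Rightarrow> 'v set set \<Rightarrow> nat \<Rightarrow> (nat \<Rightarrow> 'v set \<Rightarrow> real) \<Rightarrow> 'v set set set" where
  "pareto_optimal_cuts V E t c =
     {F \<in> cuts V E. \<not> (\<exists>F'\<in>cuts V E. dominates t c F' F)}"

text \<open>Costs are strictly positive. If zero costs were allowed, the identically zero cost
  functions would make every cut pareto-optimal.\<close>

definition edge_costs :: "'e set \<Rightarrow> nat \<Rightarrow> (nat \<Rightarrow> 'e \<Rightarrow> real) \<Rightarrow> bool" where
  "edge_costs E t c \<longleftrightarrow> (\<forall>i\<in>{1..t}. \<forall>e\<in>E. 0 < c i e)"

end

theory Submission
  imports Defs "HOL-Library.FuncSet"
begin

text \<open>Take \<open>t\<close> internally disjoint paths between two terminals whose internal vertices are the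
  remaining \<open>n - 2\<close> vertices, distributed as evenly as possible. An edge costs \<open>1\<close> in the
  coordinate of its own path and \<open>1/t\<close> in all others. A cut with exactly one edge on every path
  costs \<open>1 + (t - 1)/t < 2\<close> in every coordinate. Any cut separating the terminals uses
  every path and costs at least as much everywhere; any other cut meets some path at least twice
  and costs at least \<open>2\<close> in the coordinate of that path. Hence all cuts with one edge per path are
  pareto-optimal, and these can be chosen independently on the paths.\<close>

lemma change_between:
  fixes P :: "nat \<Rightarrow> bool"
  assumes "P a \<noteq> P b" "a \<le> b"
  obtains i where "a \<le> i" "i < b" "P i \<noteq> P (Suc i)"
proof -
  have "\<exists>i. a \<le> i \<and> i < b \<and> P i \<noteq> P (Suc i)"
  proof (rule ccontr)
    assume no: "\<nexists>i. a \<le> i \<and> i < b \<and> P i \<noteq> P (Suc i)"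
    have "i \<le> b \<Longrightarrow> P i = P a" if "a \<le> i" for i
      using that by (induction i rule: dec_induct) (use no in auto)
    with assms show False by blast
  qed
  with that show thesis by blast
qed

text \<open>The vertices are \<open>t - 1, \<dots>, M\<close>, the terminals being the two extremes. The clamped numbers
  congruent to \<open>j\<close> modulo \<open>t\<close> form the path \<open>j\<close>, so that edge \<open>k\<close> lies on path \<open>k mod t\<close>.\<close>

locale path_bundle =
  fixes t M :: nat
  assumes t_pos: "t \<ge> 1" and M_ge: "M \<ge> 2 * t"
begin

definition clamp :: "nat \<Rightarrow> nat" where
  "clamp k = max (t - 1) (min k M)"

definition edge :: "nat \<Rightarrow> nat set" where
  "edge k = {clamp k, clamp (k + t)}"

definition V :: "nat set" where
  "V = {t - 1..M}"

definition E :: "nat set set" where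
  "E = edge ` {..<M}"

text \<open>Costs take vertex sets, so the path of an edge is recovered through its index;
  \<open>Suc\<close> matches paths numbered from 0 with cost functions numbered from 1.\<close>

definition cost :: "nat \<Rightarrow> nat set \<Rightarrow> real" where
  "cost i e = (if e \<in> edge ` {k. k < M \<and> Suc (k mod t) = i} then 1 else 1 / real t)"

definition crossing :: "nat set \<Rightarrow> nat set" where
  "crossing U = {k. (clamp k \<in> U) \<noteq> (clamp (k + t) \<in> U)}"

section \<open>The graph and its indexed edges\<close>

lemma clamp_less: "k < M \<Longrightarrow> clamp k < clamp (k + t)"
  using t_pos M_ge by (auto simp: clamp_def)

lemma clamp_in_V: "clamp k \<in> V"
  using M_ge by (auto simp: clamp_def V_def)

lemma clamp_eq: "v \<in> V \<Longrightarrow> clamp v = v"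
  by (auto simp: clamp_def V_def)

lemma crossing_less: "k \<in> crossing U \<Longrightarrow> k < M"
  by (rule ccontr) (auto simp: crossing_def clamp_def)

lemma finite_crossing: "finite (crossing U)"
  by (rule finite_subset[of _ "{..<M}"]) (use crossing_less in auto)

text \<open>If the smaller end exceeds \<open>t - 1\<close>, it is the index itself. Otherwise the
  index is below \<open>t\<close>, and \<open>M_ge\<close> keeps the larger end, the index plus
  \<open>t\<close>, below \<open>M\<close>, hence unclamped. So no path is a bare edge between the
  terminals, which other paths could share.\<close>

lemma inj_on_edge: "inj_on edge {..<M}"
proof (rule inj_onI)
  fix k l assume kl: "k \<in> {..<M}" "l \<in> {..<M}" and eq: "edge k = edge l"
  have "clamp k < clamp (k + t)" "clamp l < clamp (l + t)"
    using kl by (auto intro: clamp_less)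
  with eq have "clamp k = clamp l" "clamp (k + t) = clamp (l + t)"
    by (auto simp: edge_def doubleton_eq_iff)
  with kl t_pos M_ge show "k = l"
    by (auto simp: clamp_def max_def min_def split: if_splits)
qed

lemma simple_graph: "simple_graph V E"
  unfolding simple_graph_def
proof
  show "E \<subseteq> {{u, v} |u v. u \<in> V \<and> v \<in> V \<and> u \<noteq> v}"
  proof
    fix e assume "e \<in> E"
    then obtain k where k: "k < M" "e = {clamp k, clamp (k + t)}"
      by (auto simp: E_def edge_def)
    then have "clamp k \<noteq> clamp (k + t)" using clamp_less[of k] by simp
    with k(2) clamp_in_V show "e \<in> {{u, v} |u v. u \<in> V \<and> v \<in> V \<and> u \<noteq> v}"
      by (intro CollectI exI conjI)
  qed
qed (simp add: V_def)

lemma edge_costs: "edge_costs E t cost"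
  using t_pos by (auto simp: edge_costs_def cost_def)

lemma edge_boundary_eq: "edge_boundary V E U = edge ` crossing U"
proof -
  have "(\<exists>u\<in>U. \<exists>v\<in>V - U. edge k = {u, v}) \<longleftrightarrow> k \<in> crossing U" for k
    using clamp_in_V[of k] clamp_in_V[of "k + t"]
    unfolding edge_def crossing_def doubleton_eq_iff by blast
  then show ?thesis
    using crossing_less by (auto simp: edge_boundary_def E_def)
qed

section \<open>Costs as sums over edge indices\<close>

lemma sum_cost_edge:
  assumes "K \<subseteq> {..<M}"
  shows "sum (cost i) (edge ` K) = (\<Sum>k\<in>K. if Suc (k mod t) = i then 1 else 1 / real t)"
proof -
  have "sum (cost i) (edge ` K) = (\<Sum>k\<in>K. cost i (edge k))"
    using assms by (simp add: sum.reindex inj_on_subset[OF inj_on_edge])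
  also have "\<dots> = (\<Sum>k\<in>K. if Suc (k mod t) = i then 1 else 1 / real t)"
  proof (rule sum.cong[OF refl])
    fix k assume "k \<in> K"
    then have "edge k \<in> edge ` {k. k < M \<and> Suc (k mod t) = i} \<longleftrightarrow> Suc (k mod t) = i"
      using assms inj_onD[OF inj_on_edge, of k] by auto
    then show "cost i (edge k) = (if Suc (k mod t) = i then 1 else 1 / real t)"
      by (simp add: cost_def)
  qed
  finally show ?thesis .
qed

lemma sum_transversal:
  assumes g: "\<And>j. j < t \<Longrightarrow> g j mod t = j" and i: "i \<in> {1..t}"
  shows "(\<Sum>k\<in>g ` {..<t}. if Suc (k mod t) = i then 1 else 1 / real t) = 1 + (real t - 1) / real t"
proof -
  \<comment> \<open>The residue of \<open>g j\<close> recovers \<open>j\<close>.\<close>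
  have "inj_on g {..<t}"
    by (rule inj_onI) (metis g lessThan_iff)
  then have "(\<Sum>k\<in>g ` {..<t}. if Suc (k mod t) = i then 1 else 1 / real t)
      = (\<Sum>j<t. if j = i - 1 then 1 else 1 / real t)"
    using i g by (simp add: sum.reindex) (intro sum.cong; auto)
  also have "\<dots> = 1 + (\<Sum>j\<in>{..<t} - {i - 1}. 1 / real t)"
    using i by (subst sum.remove[of _ "i - 1"]) auto
  also have "\<dots> = 1 + (real t - 1) / real t"
    using i by (subst sum_constant, subst card_Diff_singleton) (auto simp: of_nat_diff)
  finally show ?thesis .
qed

section \<open>How cuts meet the paths\<close>

lemma crossing_between:
  assumes "(clamp (j + t * a) \<in> U) \<noteq> (clamp (j + t * b) \<in> U)" "a \<le> b"
  obtains i where "a \<le> i" "i < b" "j + t * i \<in> crossing U"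
proof (rule change_between[of "\<lambda>i. clamp (j + t * i) \<in> U" a b])
  fix i assume "a \<le> i" "i < b" "(clamp (j + t * i) \<in> U) \<noteq> (clamp (j + t * Suc i) \<in> U)"
  then show thesis using that[of i] by (simp add: crossing_def algebra_simps)
qed (use assms in auto)

lemma clamp_start: "j < t \<Longrightarrow> clamp (j + t * 0) = t - 1"
  by (auto simp: clamp_def)

text \<open>Step \<open>M\<close> overshoots the end of every path and is clamped to the terminal,
  so the lengths of the individual paths need not be known.\<close>

lemma clamp_end: "clamp (j + t * M) = M"
proof -
  have "1 * M \<le> t * M" using t_pos by (rule mult_le_mono1)
  then have "min (j + t * M) M = M" by (intro min_absorb2) linarith
  then show ?thesis using M_ge by (simp add: clamp_def)
qed

lemma separating_crossing:
  assumes "(t - 1 \<in> U) \<noteq> (M \<in> U)"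
  obtains g where "\<And>j. j < t \<Longrightarrow> g j mod t = j" "g ` {..<t} \<subseteq> crossing U"
proof -
  have "\<exists>k. k mod t = j \<and> k \<in> crossing U" if j: "j < t" for j
  proof -
    obtain i where "j + t * i \<in> crossing U"
      using crossing_between[of j 0 U M] assms clamp_start[OF j] clamp_end by auto
    then show ?thesis using j by (intro exI[of _ "j + t * i"]) simp
  qed
  then obtain g where "\<And>j. j < t \<Longrightarrow> g j mod t = j \<and> g j \<in> crossing U" by metis
  then show thesis using that[of g] by auto
qed

text \<open>Some vertex lies on the other side from both terminals. Its path changes sides once
  before it and once after it.\<close>

lemma nonseparating_crossing:
  assumes U: "U \<noteq> {}" "U \<subset> V" and sep: "(t - 1 \<in> U) = (M \<in> U)"
  obtains k l where "k \<in> crossing U" "l \<in> crossing U" "k \<noteq> l" "k mod t = l mod t"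
proof -
  obtain v where v: "v \<in> V" "(v \<in> U) \<noteq> (t - 1 \<in> U)"
    using U by auto
  define j i where "j = v mod t" and "i = v div t"
  have j: "j < t" and ji: "j + t * i = v"
    using t_pos by (auto simp: j_def i_def)
  have "i \<le> v" by (simp add: i_def)
  also have "v \<le> M" using v by (simp add: V_def)
  finally have "i \<le> M" .
  have vi: "clamp (j + t * i) = v" using v ji clamp_eq by simp
  obtain a where a: "a < i" "j + t * a \<in> crossing U"
    using crossing_between[of j 0 U i] v vi clamp_start[OF j] by auto
  obtain b where b: "i \<le> b" "j + t * b \<in> crossing U"
    using crossing_between[of j i U M] v vi clamp_end sep \<open>i \<le> M\<close> by metis
  show thesis
    using that[of "j + t * a" "j + t * b"] a b t_pos by simp
qed

section \<open>Cuts with one edge per path\<close>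

lemma transversal_cut_pareto_optimal:
  assumes g: "\<And>j. j < t \<Longrightarrow> g j mod t = j" "g ` {..<t} \<subseteq> {..<M}"
    and cut: "edge ` g ` {..<t} \<in> cuts V E"
  shows "edge ` g ` {..<t} \<in> pareto_optimal_cuts V E t cost"
proof -
  have cost_g: "sum (cost i) (edge ` g ` {..<t}) = 1 + (real t - 1) / real t"
    if "i \<in> {1..t}" for i
    using that g by (simp add: sum_cost_edge sum_transversal)
  have "\<not> dominates t cost F (edge ` g ` {..<t})" if F: "F \<in> cuts V E" for F
  proof -
    obtain U where U: "U \<noteq> {}" "U \<subset> V" "F = edge ` crossing U"
      using F edge_boundary_eq by (auto simp: cuts_def)
    have cost_F: "sum (cost i) F
        = (\<Sum>k\<in>crossing U. if Suc (k mod t) = i then 1 else 1 / real t)" for i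
      unfolding U(3) by (rule sum_cost_edge) (use crossing_less in auto)
    show ?thesis
    proof (cases "(t - 1 \<in> U) = (M \<in> U)")
      case False
      then obtain h where h: "\<And>j. j < t \<Longrightarrow> h j mod t = j" "h ` {..<t} \<subseteq> crossing U"
        by (rule separating_crossing) blast
      have "1 + (real t - 1) / real t \<le> sum (cost i) F" if "i \<in> {1..t}" for i
        unfolding cost_F
        \<comment> \<open>The bound is the cost of the transversal \<open>h\<close>; the remaining
          crossing edges only add to it.\<close>
        by (subst sum_transversal[OF h(1) that, symmetric])
          (use h finite_crossing in \<open>auto intro!: sum_mono2\<close>)
      then show ?thesis using cost_g by (force simp: dominates_def)
    next
      case True
      then obtain k l where kl: "k \<in> crossing U" "l \<in> crossing U" "k \<noteq> l" "k mod t = l mod t"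
        using nonseparating_crossing U by metis
      \<comment> \<open>The coordinate of the path met twice, where both edges cost 1.\<close>
      define i where "i = Suc (k mod t)"
      have i: "i \<in> {1..t}" using t_pos by (auto simp: i_def Suc_le_eq)
      have "1 + (real t - 1) / real t < 2" using t_pos by (simp add: field_simps)
      also have "2 = (\<Sum>k\<in>{k, l}. if Suc (k mod t) = i then 1 else 1 / real t)"
        using kl by (simp add: i_def)
      also have "\<dots> \<le> sum (cost i) F"
        unfolding cost_F by (rule sum_mono2) (use kl finite_crossing in auto)
      finally show ?thesis using cost_g[OF i] i by (force simp: dominates_def)
    qed
  qed
  with cut show ?thesis by (auto simp: pareto_optimal_cuts_def)
qed

text \<open>\<open>f j\<close> is the position of the chosen edge on path \<open>j\<close>, counted
  from 0. The bound is uniform: even the shortest path has an edge at position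
  \<open>(M - t) div t\<close>.\<close>

lemma transversal_cut:
  assumes f: "\<And>j. j < t \<Longrightarrow> f j \<le> (M - t) div t"
  shows "edge ` (\<lambda>j. j + t * f j) ` {..<t} \<in> cuts V E"
    and "(\<lambda>j. j + t * f j) ` {..<t} \<subseteq> {..<M}"
proof -
  have tf: "t * f j + t \<le> M" if "j < t" for j
  proof -
    have "t * f j \<le> t * ((M - t) div t)" using f[OF that] by simp
    also have "\<dots> \<le> M - t" by simp
    finally show ?thesis using M_ge by simp
  qed
  then show sub: "(\<lambda>j. j + t * f j) ` {..<t} \<subseteq> {..<M}"
    by fastforce
  \<comment> \<open>The union of initial segments, path \<open>j\<close> being kept up to position
    \<open>f j\<close>. The terminal \<open>t - 1\<close> has quotient 0 and is always in; the
    terminal \<open>M\<close> is excluded explicitly.\<close>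
  define U where "U = {v \<in> V. v < M \<and> v div t \<le> f (v mod t)}"
  have low: "clamp k \<in> U \<longleftrightarrow> k div t \<le> f (k mod t)" if "k < M" for k
  proof (cases "k < t")
    case True
    then have "clamp k = t - 1" by (auto simp: clamp_def)
    then show ?thesis using True t_pos M_ge by (auto simp: U_def V_def)
  next
    case False
    then have "k \<in> V" using that by (auto simp: V_def)
    then show ?thesis using that by (auto simp: U_def clamp_eq)
  qed
  have high: "clamp (k + t) \<in> U \<longleftrightarrow> Suc (k div t) \<le> f (k mod t)" if "k < M" for k
  proof (cases "k + t < M")
    case True
    then have "(k + t) div t = Suc (k div t)" using t_pos by simp
    then show ?thesis using low[OF True] by simp
  next
    case False
    \<comment> \<open>The far end is the terminal \<open>M\<close>, outside \<open>U\<close>. If the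
      right side held, \<open>tf\<close> would give \<open>k + t < M\<close>.\<close>
    have "\<not> Suc (k div t) \<le> f (k mod t)"
    proof
      assume "Suc (k div t) \<le> f (k mod t)"
      then have "t * Suc (k div t) \<le> t * f (k mod t)" by (rule mult_le_mono2)
      moreover have "k < t * Suc (k div t)"
        using t_pos dividend_less_times_div[of t k] by simp
      ultimately show False using tf[of "k mod t"] t_pos False by simp
    qed
    moreover have "clamp (k + t) = M" using False M_ge by (auto simp: clamp_def)
    ultimately show ?thesis by (simp add: U_def)
  qed
  have "k \<in> crossing U \<longleftrightarrow> k div t = f (k mod t)" if "k < M" for k
    using low[OF that] high[OF that] by (auto simp: crossing_def)
  then have "crossing U = {k. k < M \<and> k div t = f (k mod t)}"
    using crossing_less by blast
  also have "\<dots> = (\<lambda>j. j + t * f j) ` {..<t}"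
  proof (intro equalityI subsetI)
    fix k assume "k \<in> {k. k < M \<and> k div t = f (k mod t)}"
    then have "k = k mod t + t * f (k mod t)"
      by (metis (lifting) mem_Collect_eq mod_mult_div_eq)
    then show "k \<in> (\<lambda>j. j + t * f j) ` {..<t}"
      by (rule image_eqI) (use t_pos in simp)
  qed (use sub in auto)
  finally have "edge_boundary V E U = edge ` (\<lambda>j. j + t * f j) ` {..<t}"
    by (simp only: edge_boundary_eq)
  moreover have "t - 1 \<in> U" "M \<in> V" "M \<notin> U" "U \<subseteq> V"
    using M_ge t_pos by (auto simp: U_def V_def)
  ultimately show "edge ` (\<lambda>j. j + t * f j) ` {..<t} \<in> cuts V E"
    unfolding cuts_def by blast
qed

section \<open>Counting the choices of positions\<close>

lemma card_pareto_optimal_cuts: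
  "Suc ((M - t) div t) ^ t \<le> card (pareto_optimal_cuts V E t cost)"
proof -
  \<comment> \<open>Extensional functions are determined by their values on the \<open>t\<close>
    paths, as injectivity of \<open>F\<close> requires.\<close>
  define A where "A = {..<t} \<rightarrow>\<^sub>E {..(M - t) div t}"
  define F where "F f = edge ` (\<lambda>j. j + t * f j) ` {..<t}" for f
  have A: "f j \<le> (M - t) div t" if "f \<in> A" "j < t" for f j
    using that by (auto simp: A_def)
  have "inj_on F A"
  proof (rule inj_onI)
    fix f g assume fg: "f \<in> A" "g \<in> A" and "F f = F g"
    then have eq: "(\<lambda>j. j + t * f j) ` {..<t} = (\<lambda>j. j + t * g j) ` {..<t}"
      unfolding F_def
      using inj_on_image_eq_iff[OF inj_on_edge] transversal_cut(2) A by metis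
    have "f j = g j" if j: "j < t" for j
    proof -
      obtain l where l: "l < t" "j + t * f j = l + t * g l"
        using eq j by (metis (lifting) image_iff lessThan_iff)
      \<comment> \<open>Compare residues modulo \<open>t\<close>.\<close>
      then have "j = l"
        using j by (metis mod_less mod_mult_self2)
      then show ?thesis using l t_pos by simp
    qed
    with fg show "f = g" by (auto simp: A_def intro: PiE_ext)
  qed
  moreover have "F ` A \<subseteq> pareto_optimal_cuts V E t cost"
    unfolding F_def using transversal_cut A
    by (auto intro!: transversal_cut_pareto_optimal)
  moreover have "finite (pareto_optimal_cuts V E t cost)"
    by (rule finite_subset[of _ "Pow E"])
      (auto simp: pareto_optimal_cuts_def cuts_def edge_boundary_def E_def)
  ultimately have "card A \<le> card (pareto_optimal_cuts V E t cost)"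
    by (rule card_inj_on_le)
  then show ?thesis by (simp add: A_def card_PiE)
qed

end

theorem theorem7:
  fixes t n :: nat
  assumes "t \<ge> 1" and "n \<ge> t + 2"
  shows "\<exists>(V :: nat set) (E :: nat set set) (c :: nat \<Rightarrow> nat set \<Rightarrow> real).
           simple_graph V E \<and> card V = n \<and> edge_costs E t c \<and>
           real (card (pareto_optimal_cuts V E t c)) \<ge> ((real n - 2) / real t) ^ t"
proof -
  \<comment> \<open>With this \<open>M\<close> there are \<open>M - t = n - 2\<close> internal
    vertices besides the two terminals, and \<open>n >= t + 2\<close> becomes
    \<open>M >= 2 * t\<close>.\<close>
  interpret path_bundle t "n - 2 + t"
    using assms by unfold_locales auto
  have "n - 2 < t * Suc ((n - 2) div t)"
    using assms dividend_less_times_div[of t "n - 2"] by simp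
  then have "real (n - 2) \<le> real t * real (Suc ((n - 2) div t))"
    by (metis less_imp_le of_nat_le_iff of_nat_mult)
  then have "(real n - 2) / real t \<le> real (Suc ((n - 2) div t))"
    using assms by (simp add: of_nat_diff field_simps)
  then have "((real n - 2) / real t) ^ t \<le> real (Suc ((n - 2) div t)) ^ t"
    using assms by (intro power_mono) auto
  also have "\<dots> \<le> real (card (pareto_optimal_cuts V E t cost))"
    using card_pareto_optimal_cuts by (metis add_diff_cancel_right' of_nat_le_iff of_nat_power)
  finally have "((real n - 2) / real t) ^ t \<le> real (card (pareto_optimal_cuts V E t cost))" .
  moreover have "card V = n"
    unfolding V_def using assms by simp
  ultimately show ?thesis
    using simple_graph edge_costs by blast
qed

end
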